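(* Let $n \ge 0$ be an integer and let $k \in \mathbb{N}$, $k\ge 1$. Then $$D_n^{(k)} = n! \sum_{\substack{l_1+l_2+\cdots+l_k = n+k}} \frac{(-1)^n}{l_1 l_2 \cdots l_k},$$ where the sum runs over all $k$-tuples $(l_1,\dots,l_k)$ of positive integers with $l_1+\cdots+l_k = n+k$.
   Context: For $k\in\mathbb{N}$, the Daehee numbers of the first kind of order $k$, $D_n^{(k)}$ ($n\ge 0$), are defined by the formal power series identity $$\sum_{n=0}^\infty D_n^{(k)} \frac{t^n}{n!} = \left(\frac{\log(1+t)}{t}\right)^k,$$ where $\log(1+t)=\sum_{l\ge 1}\frac{(-1)^{l-1}}{l}t^l$. *)

theory Defs
  imports Complex_Main "HOL-Computational_Algebra.Formal_Power_Series"
begin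

text \<open>
  The library's \<^term>\<open>fps_ln c\<close> is the expansion of \<open>log(1 + t) / c\<close>, so
  \<^term>\<open>fps_ln 1\<close> is \<open>log(1 + t)\<close>, without constant term. As \<^term>\<open>fps_X\<close> divides it,
  the quotient below is the exact quotient \<open>log(1 + t) / t\<close> (not the fallback value
  of an inexact division).
\<close>

lemma fps_ln_1_eq:
  "fps_ln (1::rat) = Abs_fps (\<lambda>l. if l = 0 then 0 else (- 1) ^ (l - 1) / of_nat l)"
  by (simp add: fps_ln_def)

lemma fps_X_mult_fps_ln_div_fps_X: "fps_X * (fps_ln (1::rat) / fps_X) = fps_ln 1"
  by (rule dvd_mult_div_cancel) simp

text \<open>
  \<open>daehee k n\<close> is the Daehee number of the first kind of order \<open>k\<close> with index \<open>n\<close>;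
  the order is the first argument.
\<close>

definition daehee :: "nat \<Rightarrow> nat \<Rightarrow> rat" where
  "daehee k n = fact n * fps_nth ((fps_ln 1 / fps_X) ^ k) n"

lemma daehee_egf: "Abs_fps (\<lambda>n. daehee k n / fact n) = (fps_ln 1 / fps_X) ^ k"
  by (rule fps_ext) (simp add: daehee_def)

text \<open>The \<open>k\<close>-tuples of positive integers with sum \<open>m\<close>, as lists of length \<open>k\<close>.\<close>

definition pos_tuples :: "nat \<Rightarrow> nat \<Rightarrow> nat list set" where
  "pos_tuples k m = {ls. length ls = k \<and> (\<forall>l\<in>set ls. l \<ge> 1) \<and> sum_list ls = m}"

lemma finite_pos_tuples: "finite (pos_tuples k m)"
proof (rule finite_subset)
  show "pos_tuples k m \<subseteq> {ls. set ls \<subseteq> {..m} \<and> length ls = k}"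
    using member_le_sum_list by (fastforce simp: pos_tuples_def)
  show "finite {ls. set ls \<subseteq> {..m} \<and> length ls = k}"
    by (rule finite_lists_length_eq) simp
qed

end

theory Submission
  imports Defs
begin

text \<open>
  Since \<open>log(1 + t) / t\<close> has coefficients \<open>(-1)\<^sup>i / (i + 1)\<close>, expanding its \<open>k\<close>-th power
  by the Cauchy product gives a sum over \<open>k\<close>-tuples of exponents \<open>i\<^sub>j\<close> with sum \<open>n\<close>;
  substituting \<open>l\<^sub>j = i\<^sub>j + 1\<close> yields the positive tuples with sum \<open>n + k\<close>, each carrying
  the sign \<open>(-1)\<^sup>n\<close>.
\<close>

text \<open>This bound keeps the truncated subtractions \<open>n - i\<close> and
  \<open>sum_list ls - length ls\<close> exact later on.\<close>

lemma length_le_sum_list: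
  fixes ls :: "nat list"
  assumes "\<forall>l\<in>set ls. l \<ge> 1"
  shows "length ls \<le> sum_list ls"
  using assms by (induction ls) auto

lemma pos_tuples_0: "pos_tuples 0 m = (if m = 0 then {[]} else {})"
  by (auto simp: pos_tuples_def)

text \<open>Splitting off the head \<open>Suc i\<close> mirrors one Cauchy product: \<open>i\<close>
  is the exponent taken from the first factor, and \<open>n - i\<close> is left for the other
  \<open>k\<close>.\<close>

lemma bij_betw_pos_tuples_Suc:
  "bij_betw (\<lambda>(i, ls). Suc i # ls)
     (SIGMA i:{0..n}. pos_tuples k (n - i + k)) (pos_tuples (Suc k) (n + Suc k))"
proof (rule bij_betwI[where g = "\<lambda>ls. (hd ls - 1, tl ls)"])
  show "(\<lambda>ls. (hd ls - 1, tl ls)) \<in> pos_tuples (Suc k) (n + Suc k)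
          \<rightarrow> (SIGMA i:{0..n}. pos_tuples k (n - i + k))"
  proof
    fix ls assume "ls \<in> pos_tuples (Suc k) (n + Suc k)"
    then obtain l ls' where "ls = l # ls'" "l \<ge> 1" "length ls' = k"
      "\<forall>l\<in>set ls'. l \<ge> 1" "l + sum_list ls' = n + Suc k"
      by (cases ls) (auto simp: pos_tuples_def)
    \<comment> \<open>The tail sums to at least \<open>k\<close>, which forces
      \<open>l - 1 \<le> n\<close>.\<close>
    then show "(hd ls - 1, tl ls) \<in> (SIGMA i:{0..n}. pos_tuples k (n - i + k))"
      using length_le_sum_list[of ls'] by (auto simp: pos_tuples_def)
  qed
next
  fix ls assume "ls \<in> pos_tuples (Suc k) (n + Suc k)"
  then show "(\<lambda>(i, ls). Suc i # ls) (hd ls - 1, tl ls) = ls"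
    by (cases ls) (auto simp: pos_tuples_def)
qed (auto simp: pos_tuples_def)

text \<open>Induction on \<open>k\<close>, peeling off one factor \<open>F\<close>; positive entries
  \<open>l\<close> encode the exponents \<open>l - 1\<close>, so \<open>k\<close> factors raise the
  total from \<open>n\<close> to \<open>n + k\<close>.\<close>

lemma fps_nth_power_pos_tuples:
  fixes F :: "'a::comm_ring_1 fps"
  shows "fps_nth (F ^ k) n =
    (\<Sum>ls\<in>pos_tuples k (n + k). \<Prod>l\<leftarrow>ls. fps_nth F (l - 1))"
proof (induction k arbitrary: n)
  case 0
  show ?case by (simp add: pos_tuples_0)
next
  case (Suc k)
  let ?c = "\<lambda>ls. \<Prod>l\<leftarrow>ls. fps_nth F (l - 1)"
  have "fps_nth (F ^ Suc k) n =
      (\<Sum>i=0..n. \<Sum>ls\<in>pos_tuples k (n - i + k). ?c (Suc i # ls))"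
    by (simp add: fps_mult_nth Suc.IH sum_distrib_left)
  also have "\<dots> = (\<Sum>(i, ls)\<in>(SIGMA i:{0..n}. pos_tuples k (n - i + k)). ?c (Suc i # ls))"
    by (rule sum.Sigma) (auto simp: finite_pos_tuples)
  also have "\<dots> = (\<Sum>ls\<in>pos_tuples (Suc k) (n + Suc k). ?c ls)"
    by (subst sum.reindex_bij_betw[OF bij_betw_pos_tuples_Suc, symmetric])
       (simp add: case_prod_unfold)
  finally show ?case .
qed

lemma fps_nth_ln_div_X:
  assumes "l \<ge> 1"
  shows "fps_nth (fps_ln (1::rat) / fps_X) (l - 1) = (- 1) ^ (l - 1) / of_nat l"
proof -
  \<comment> \<open>Multiplication by \<open>fps_X\<close> shifts the index up by one, so exactness
    of the division can be used.\<close>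
  have "fps_nth (fps_ln (1::rat) / fps_X) (l - 1) = fps_nth (fps_X * (fps_ln 1 / fps_X)) l"
    using assms by (simp only: fps_X_mult_nth) simp
  also have "\<dots> = (- 1) ^ (l - 1) / of_nat l"
    unfolding fps_X_mult_fps_ln_div_fps_X using assms by (simp add: fps_ln_1_eq)
  finally show ?thesis .
qed

text \<open>The sign exponents \<open>l - 1\<close> add up to the sum minus the length.\<close>

lemma prod_list_alternating_reciprocals:
  assumes "\<forall>l\<in>set ls. l \<ge> 1"
  shows "(\<Prod>l\<leftarrow>ls. (- 1) ^ (l - 1) / of_nat l :: 'a::field_char_0) =
    (- 1) ^ (sum_list ls - length ls) / (\<Prod>l\<leftarrow>ls. of_nat l)"
  using assms
proof (induction ls)
  case (Cons l ls)
  then have "sum_list (l # ls) - length (l # ls) = (l - 1) + (sum_list ls - length ls)"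
    using length_le_sum_list[of ls] by simp
  then have "(- 1 :: 'a) ^ (sum_list (l # ls) - length (l # ls)) =
      (- 1) ^ (l - 1) * (- 1) ^ (sum_list ls - length ls)"
    by (simp only: power_add)
  with Cons show ?case by simp
qed simp

theorem theorem2p1:
  fixes n k :: nat
  assumes "k \<ge> 1"
  shows "daehee k n =
    fact n * (\<Sum>ls\<in>pos_tuples k (n + k). (- 1) ^ n / (\<Prod>l\<leftarrow>ls. of_nat l))"
proof -
  have "(\<Prod>l\<leftarrow>ls. fps_nth (fps_ln (1::rat) / fps_X) (l - 1)) =
      (- 1) ^ n / (\<Prod>l\<leftarrow>ls. of_nat l)" if "ls \<in> pos_tuples k (n + k)" for ls
  proof -
    \<comment> \<open>Here the exponent is \<open>(n + k) - k\<close>, so all tuples share the same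
      sign.\<close>
    have ls: "\<forall>l\<in>set ls. l \<ge> 1" "sum_list ls - length ls = n"
      using that by (auto simp: pos_tuples_def)
    then have "(\<Prod>l\<leftarrow>ls. fps_nth (fps_ln (1::rat) / fps_X) (l - 1)) =
        (\<Prod>l\<leftarrow>ls. (- 1) ^ (l - 1) / of_nat l)"
      by (intro arg_cong[where f = prod_list] map_cong refl fps_nth_ln_div_X) blast
    with prod_list_alternating_reciprocals[OF ls(1)] ls(2) show ?thesis
      by simp
  qed
  then show ?thesis
    by (simp add: daehee_def fps_nth_power_pos_tuples)
qed

end
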